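(* Let $\mathbf{u}$ be an infinite word over a ternary alphabet $\mathcal{A}$ whose language $\mathcal{L}(\mathbf{u})$ is closed under reversal. If the complexity of $\mathbf{u}$ satisfies $\mathcal{C}(n)=2n+1$ for every $n\in\mathbb{N}$ and $\mathbf{u}$ has no maximal left special factor, then $\mathbf{u}$ has the property $\mathcal{PE}$: for every palindrome $p\in\mathcal{L}(\mathbf{u})$ there exists exactly one letter $a\in\mathcal{A}$ such that $apa\in\mathcal{L}(\mathbf{u})$.
   Context: $\mathbb{N}$ includes $0$. The language $\mathcal{L}(\mathbf{u})$ is the set of all finite factors of $\mathbf{u}$ (including the empty word); $\mathcal{L}_n(\mathbf{u})$ is the set of factors of length $n$ and $\mathcal{C}(n)=\#\mathcal{L}_n(\mathbf{u})$. The reversal of $w=w_0\cdots w_{n-1}$ is $\overline{w}=w_{n-1}\cdots w_0$; a palindrome satisfies $w=\overline{w}$; the language is closed under reversal if $w\in\mathcal{L}(\mathbf{u})\Rightarrow\overline{w}\in\mathcal{L}(\mathbf{u})$. A factor $w$ is left special if there are two distinct letters $a,b$ with $aw,bw\in\mathcal{L}(\mathbf{u})$. A left special factor $w$ is maximal if for no letter $c\in\mathcal{A}$ is $wc$ left special. *)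

theory Defs
  imports "HOL-Library.Omega_Words_Fun"
begin

text \<open>
  Infinite words are one-sided; the alphabet \<open>A\<close> is a set of letters rather than a type.
  Since the interval below may be empty, the empty word is a factor of every infinite word.
\<close>

definition language :: "'a word \<Rightarrow> 'a list set" where
  "language u = {w. \<exists>i j. i \<le> j \<and> w = u [i \<rightarrow> j]}"

definition factors :: "'a word \<Rightarrow> nat \<Rightarrow> 'a list set" where
  "factors u n = {w \<in> language u. length w = n}"

definition complexity :: "'a word \<Rightarrow> nat \<Rightarrow> nat" where
  "complexity u n = card (factors u n)"

definition palindrome :: "'a list \<Rightarrow> bool" where
  "palindrome w \<longleftrightarrow> w = rev w"

definition closed_under_reversal :: "'a word \<Rightarrow> bool" where
  "closed_under_reversal u \<longleftrightarrow> (\<forall>w \<in> language u. rev w \<in> language u)"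

definition left_special :: "'a set \<Rightarrow> 'a word \<Rightarrow> 'a list \<Rightarrow> bool" where
  "left_special A u w \<longleftrightarrow> w \<in> language u \<and>
     (\<exists>a\<in>A. \<exists>b\<in>A. a \<noteq> b \<and> a # w \<in> language u \<and> b # w \<in> language u)"

definition maximal_left_special :: "'a set \<Rightarrow> 'a word \<Rightarrow> 'a list \<Rightarrow> bool" where
  "maximal_left_special A u w \<longleftrightarrow>
     left_special A u w \<and> (\<nexists>c. c \<in> A \<and> left_special A u (w @ [c]))"

definition property_PE :: "'a set \<Rightarrow> 'a word \<Rightarrow> bool" where
  "property_PE A u \<longleftrightarrow>
     (\<forall>p \<in> language u. palindrome p \<longrightarrow> (\<exists>!a. a \<in> A \<and> a # p @ [a] \<in> language u))"

end

theory Submission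
  imports Defs
begin

text \<open>
  Call \<open>|Lext w| - 1\<close> the excess of a factor \<open>w\<close>. Over the factors of a fixed length the excesses
  sum to 2, and since no left special factor is maximal, the excess of \<open>w\<close> equals the total
  excess of its right extensions. Hence a palindrome \<open>p\<close> with \<open>k\<close> left extensions has exactly
  \<open>2k - 1\<close> two-sided extensions; these form a symmetric relation, so the number of letters \<open>a\<close>
  with \<open>apa\<close> a factor is odd. It can differ from 1 only if it is 3, and then some letter \<open>c\<close>
  satisfies: \<open>cpx\<close> is a factor only for \<open>x = c\<close>.

  In that case \<open>p\<close> is the only left or right special factor of its length. As every
  palindrome extends to a palindrome, there are at least four palindromes of length \<open>|p|\<close> or
  \<open>|p| + 1\<close>, and this forces all complete returns to \<open>p\<close> to be palindromes. So after an occurrence of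
  \<open>pc\<close> the next \<open>p\<close> is preceded, hence followed, by \<open>c\<close>, and so on forever, which contradicts
  recurrence.
\<close>

text \<open>Off-diagonal pairs cancel in twos: removing \<open>(x, y)\<close> together with
  \<open>(y, x)\<close> keeps the parity of \<open>card E\<close> and leaves the diagonal
  unchanged.\<close>

lemma odd_card_symmetric_relation:
  assumes "finite E" and "\<And>x y. (x, y) \<in> E \<Longrightarrow> (y, x) \<in> E"
  shows "odd (card E) \<longleftrightarrow> odd (card {x. (x, x) \<in> E})"
  using assms
proof (induction "card E" arbitrary: E rule: less_induct)
  case less
  show ?case
  proof (cases "E \<subseteq> Id")
    case True
    then have "E = (\<lambda>x. (x, x)) ` {x. (x, x) \<in> E}"
      by auto
    then have "card E = card {x. (x, x) \<in> E}"
      by (metis (no_types, lifting) card_image inj_onI prod.inject)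
    then show ?thesis
      by simp
  next
    case False
    then obtain x y where xy: "(x, y) \<in> E" "x \<noteq> y"
      by auto
    define F where "F = E - {(x, y), (y, x)}"
    have yx: "(y, x) \<in> E"
      using less.prems(2) xy(1) .
    have sub: "{(x, y), (y, x)} \<subseteq> E"
      using xy yx by simp
    have c2: "card {(x, y), (y, x)} = 2"
      using xy(2) by simp
    have cF: "card F = card E - 2" "2 \<le> card E"
      unfolding F_def using card_Diff_subset[OF _ sub] card_mono[OF less.prems(1) sub] c2 by simp_all
    have "odd (card F) \<longleftrightarrow> odd (card {z. (z, z) \<in> F})"
    proof (rule less.hyps)
      show "card F < card E" "finite F"
        using cF less.prems(1) by (simp_all add: F_def)
      show "(s, r) \<in> F" if "(r, s) \<in> F" for r s
        using that less.prems(2) unfolding F_def by auto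
    qed
    moreover have "{z. (z, z) \<in> F} = {z. (z, z) \<in> E}"
      using xy(2) by (auto simp: F_def)
    moreover have "odd (card F) \<longleftrightarrow> odd (card E)"
      using cF by simp
    ultimately show ?thesis
      by simp
  qed
qed

section \<open>Factors of an infinite word and their extensions\<close>

lemma language_iff: "w \<in> language u \<longleftrightarrow> (\<exists>i. w = u [i \<rightarrow> i + length w])"
proof
  assume "w \<in> language u"
  then obtain i j where "i \<le> j" "w = u [i \<rightarrow> j]"
    by (auto simp: language_def)
  then show "\<exists>i. w = u [i \<rightarrow> i + length w]"
    by (intro exI[of _ i]) simp
next
  assume "\<exists>i. w = u [i \<rightarrow> i + length w]"
  then show "w \<in> language u"
    unfolding language_def by (auto intro: le_add1)
qed

lemma subsequence_in_language: "u [i \<rightarrow> j] \<in> language u"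
proof (cases "i \<le> j")
  case False
  then have "u [i \<rightarrow> j] = u [0 \<rightarrow> 0]"
    by simp
  then show ?thesis
    unfolding language_def by blast
qed (auto simp: language_def)

lemma language_factor:
  assumes "x @ y @ z \<in> language u"
  shows "y \<in> language u"
proof -
  obtain i where i: "x @ y @ z = u [i \<rightarrow> i + length (x @ y @ z)]"
    using assms language_iff by metis
  have "y = take (length y) (drop (length x) (x @ y @ z))"
    by simp
  also have "\<dots> = u [i + length x \<rightarrow> i + length x + length y]"
    by (subst i) (simp add: subsequence_def take_map drop_map)
  finally show ?thesis
    by (metis subsequence_in_language)
qed

lemma language_prefix: "x @ y \<in> language u \<Longrightarrow> x \<in> language u"
  using language_factor[of "[]" x y] by simp

lemma language_suffix: "x @ y \<in> language u \<Longrightarrow> y \<in> language u"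
  using language_factor[of x y "[]"] by simp

lemma language_tl: "x # y \<in> language u \<Longrightarrow> y \<in> language u"
  using language_suffix[of "[x]" y] by simp

lemma language_window: "w \<in> language u \<Longrightarrow> take k (drop q w) \<in> language u"
  using language_factor[of "take q w" "take k (drop q w)" "drop k (drop q w)" u]
  by (simp del: drop_drop)

definition left_ext :: "'a word \<Rightarrow> 'a list \<Rightarrow> 'a set" where
  "left_ext u w = {a. a # w \<in> language u}"

definition right_ext :: "'a word \<Rightarrow> 'a list \<Rightarrow> 'a set" where
  "right_ext u w = {a. w @ [a] \<in> language u}"

definition both_ext :: "'a word \<Rightarrow> 'a list \<Rightarrow> ('a \<times> 'a) set" where
  "both_ext u w = {(a, b). a # w @ [b] \<in> language u}"

lemma right_ext_nonempty:
  assumes "w \<in> language u"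
  shows "right_ext u w \<noteq> {}"
proof -
  obtain i where "w = u [i \<rightarrow> i + length w]"
    using assms language_iff by metis
  then have "w @ [u (i + length w)] = u [i \<rightarrow> Suc (i + length w)]"
    by (simp add: subsequence_def)
  then show ?thesis
    unfolding right_ext_def using subsequence_in_language[of u] by (metis empty_iff mem_Collect_eq)
qed

section \<open>Words whose language is closed under reversal\<close>

locale reversal_closed_word =
  fixes A :: "'a set" and u :: "'a word"
  assumes finite_alphabet: "finite A"
    and word_over_A: "range u \<subseteq> A"
    and reversal: "closed_under_reversal u"
begin

lemma rev_in_language [simp]: "rev w \<in> language u \<longleftrightarrow> w \<in> language u"
  using reversal unfolding closed_under_reversal_def by (metis rev_rev_ident)

lemma left_ext_rev: "left_ext u (rev w) = right_ext u w"
  unfolding left_ext_def right_ext_def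
  by (metis rev.simps(2) rev_in_language rev_rev_ident)

lemma left_ext_nonempty: "w \<in> language u \<Longrightarrow> left_ext u w \<noteq> {}"
  using right_ext_nonempty[of "rev w" u] left_ext_rev[of "rev w"] by simp

lemma letters_in_alphabet: "w \<in> language u \<Longrightarrow> set w \<subseteq> A"
  using word_over_A by (auto simp: language_def subsequence_def image_subset_iff)

lemma left_ext_subset: "left_ext u w \<subseteq> A"
  using letters_in_alphabet by (fastforce simp: left_ext_def)

lemma right_ext_subset: "right_ext u w \<subseteq> A"
  using left_ext_subset[of "rev w"] left_ext_rev by simp

lemma finite_left_ext [simp]: "finite (left_ext u w)"
  using finite_alphabet left_ext_subset finite_subset by blast

lemma finite_right_ext [simp]: "finite (right_ext u w)"
  using finite_alphabet right_ext_subset finite_subset by blast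

lemma finite_factors [simp]: "finite (factors u n)"
  by (rule finite_subset[OF _ finite_lists_length_eq[OF finite_alphabet, of n]])
    (use letters_in_alphabet in \<open>auto simp: factors_def\<close>)

lemma card_left_ext_pos: "w \<in> language u \<Longrightarrow> card (left_ext u w) \<ge> 1"
  using left_ext_nonempty[of w] by (simp add: Suc_le_eq card_gt_0_iff)

text \<open>This is recurrence. Reversal supplies left extensions of every length, and a copy of
  \<open>w\<close> preceded by \<open>N\<close> letters cannot start before position
  \<open>N\<close>.\<close>

lemma occurs_beyond:
  assumes "w \<in> language u"
  shows "\<exists>k\<ge>N. w = u [k \<rightarrow> k + length w]"
proof -
  have "\<exists>z. length z = N \<and> z @ w \<in> language u"
  proof (induction N)
    case 0
    then show ?case using assms by simp
  next
    case (Suc N)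
    then obtain z where z: "length z = N" "z @ w \<in> language u"
      by blast
    obtain a where "a # z @ w \<in> language u"
      using left_ext_nonempty[OF z(2)] by (auto simp: left_ext_def)
    then show ?case
      using z(1) by (intro exI[of _ "a # z"]) simp
  qed
  then obtain z k where z: "length z = N" "z @ w = u [k \<rightarrow> k + length (z @ w)]"
    using language_iff by metis
  have "w = drop N (z @ w)"
    using z(1) by simp
  also have "\<dots> = u [k + N \<rightarrow> k + N + length w]"
    by (subst z(2)) (use z(1) in \<open>simp add: subsequence_def drop_map add.assoc\<close>)
  finally show ?thesis
    by (intro exI[of _ "k + N"]) simp
qed

text \<open>Splitting off the first letter matches the factors of length \<open>Suc n\<close> with
  the pairs of a factor of length \<open>n\<close> and one of its left extensions.\<close>

lemma card_factors_Suc: "card (factors u (Suc n)) = (\<Sum>w\<in>factors u n. card (left_ext u w))"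
proof -
  have "factors u (Suc n) = (\<lambda>(w, a). a # w) ` (SIGMA w:factors u n. left_ext u w)"
  proof (intro equalityI subsetI)
    fix x assume "x \<in> factors u (Suc n)"
    then obtain a w where "x = a # w" "x \<in> language u" "length w = n"
      unfolding factors_def by (auto simp: length_Suc_conv)
    then have "(w, a) \<in> (SIGMA w:factors u n. left_ext u w)" "x = (\<lambda>(w, a). a # w) (w, a)"
      using language_tl by (auto simp: factors_def left_ext_def)
    then show "x \<in> (\<lambda>(w, a). a # w) ` (SIGMA w:factors u n. left_ext u w)"
      by blast
  qed (auto simp: factors_def left_ext_def)
  moreover have "inj_on (\<lambda>(w, a). a # w) (SIGMA w:factors u n. left_ext u w)"
    by (auto simp: inj_on_def)
  ultimately have "card (factors u (Suc n)) = card (SIGMA w:factors u n. left_ext u w)"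
    by (simp add: card_image)
  then show ?thesis
    by (simp add: card_SigmaI)
qed

lemma sum_factors_Suc:
  "(\<Sum>w\<in>factors u (Suc n). f w) = (\<Sum>w\<in>factors u n. \<Sum>c\<in>right_ext u w. f (w @ [c]))"
proof -
  have "(\<Sum>w\<in>factors u n. \<Sum>c\<in>right_ext u w. f (w @ [c])) =
      (\<Sum>(w, c)\<in>(SIGMA w:factors u n. right_ext u w). f (w @ [c]))"
    by (simp add: sum.Sigma)
  also have "\<dots> = (\<Sum>w\<in>factors u (Suc n). f w)"
  proof (rule sum.reindex_bij_witness[where i = "\<lambda>w. (butlast w, last w)" and j = "\<lambda>(w, c). w @ [c]"])
    fix x assume x: "x \<in> factors u (Suc n)"
    then have "x \<noteq> []"
      by (auto simp: factors_def)
    then have eq: "butlast x @ [last x] = x"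
      by simp
    then show "(\<lambda>(w, c). w @ [c]) (butlast x, last x) = x"
      by simp
    have "butlast x \<in> language u"
      using x eq language_prefix[of "butlast x" "[last x]" u] by (simp add: factors_def)
    then show "(butlast x, last x) \<in> (SIGMA w:factors u n. right_ext u w)"
      using x eq by (auto simp: factors_def right_ext_def)
  qed (auto simp: factors_def right_ext_def)
  finally show ?thesis ..
qed

lemma card_both_ext: "card (both_ext u w) = (\<Sum>c\<in>right_ext u w. card (left_ext u (w @ [c])))"
proof -
  have "both_ext u w = (\<lambda>(c, a). (a, c)) ` (SIGMA c:right_ext u w. left_ext u (w @ [c]))"
    using language_tl by (force simp: both_ext_def left_ext_def right_ext_def)
  moreover have "inj_on (\<lambda>(c, a). (a, c)) (SIGMA c:right_ext u w. left_ext u (w @ [c]))"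
    by (auto simp: inj_on_def)
  ultimately have "card (both_ext u w) = card (SIGMA c:right_ext u w. left_ext u (w @ [c]))"
    by (simp add: card_image)
  then show ?thesis
    by (simp add: card_SigmaI)
qed

lemma finite_both_ext [simp]: "finite (both_ext u w)"
proof (rule finite_subset)
  show "both_ext u w \<subseteq> A \<times> A"
    using letters_in_alphabet by (fastforce simp: both_ext_def)
qed (simp add: finite_alphabet)

lemma palindrome_both_ext_sym:
  assumes "palindrome p" "(a, b) \<in> both_ext u p"
  shows "(b, a) \<in> both_ext u p"
  using assms rev_in_language[of "a # p @ [b]"] by (simp add: both_ext_def palindrome_def)

lemma left_special_iff: "left_special A u w \<longleftrightarrow> w \<in> language u \<and> card (left_ext u w) \<ge> 2"
proof -
  have "card (left_ext u w) \<ge> 2 \<longleftrightarrow> (\<exists>a b. a \<in> left_ext u w \<and> b \<in> left_ext u w \<and> a \<noteq> b)"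
  proof -
    have "card (left_ext u w) \<ge> 2 \<longleftrightarrow> \<not> card (left_ext u w) \<le> Suc 0"
      by linarith
    then show ?thesis
      by (auto simp: card_le_Suc0_iff_eq)
  qed
  then show ?thesis
    using left_ext_subset[of w] unfolding left_special_def left_ext_def by blast
qed

end

section \<open>Excess and two-sided extensions under complexity 2n + 1\<close>

locale ternary_word = reversal_closed_word +
  assumes ternary: "card A = 3"
    and compl: "complexity u n = 2 * n + 1"
    and no_max: "\<not> maximal_left_special A u w"
begin

text \<open>The truncated subtraction is harmless on factors, which always have a left extension; a
  factor is left special iff its excess is positive.\<close>

definition excess :: "'a list \<Rightarrow> nat" where
  "excess w = card (left_ext u w) - 1"

text \<open>The sum is the first difference of the complexity, and (2(n + 1) + 1) - (2n + 1) =
  2.\<close>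

lemma sum_excess: "(\<Sum>w\<in>factors u n. excess w) = 2"
proof -
  have "(\<Sum>w\<in>factors u n. card (left_ext u w)) = (\<Sum>w\<in>factors u n. excess w + 1)"
    by (intro sum.cong) (auto simp: excess_def factors_def dest!: card_left_ext_pos)
  then show ?thesis
    using card_factors_Suc[of n] compl[of n] compl[of "Suc n"]
    by (simp add: complexity_def sum_Suc)
qed

lemma excess_unique:
  assumes "w \<in> factors u n" "excess w \<ge> 2" "v \<in> factors u n" "v \<noteq> w"
  shows "excess v = 0"
proof -
  have "excess w + excess v = (\<Sum>x\<in>{w, v}. excess x)"
    using assms(4) by simp
  also have "\<dots> \<le> 2"
    unfolding sum_excess[of n, symmetric] using assms by (intro sum_mono2) auto
  finally show ?thesis
    using assms(2) by simp
qed

text \<open>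
  Both sides sum to 2 over all factors of a given length. The absence of maximal left special
  factors makes the left-hand side positive wherever the right-hand side is, which leaves no
  room for them to differ.
\<close>

lemma sum_excess_extensions:
  assumes "w \<in> language u"
  shows "(\<Sum>c\<in>right_ext u w. excess (w @ [c])) = excess w"
proof -
  define s where "s w = (\<Sum>c\<in>right_ext u w. excess (w @ [c]))" for w
  define n where "n = length w"
  have w: "w \<in> factors u n"
    using assms by (simp add: n_def factors_def)
  have sums: "(\<Sum>w\<in>factors u n. s w) = (\<Sum>w\<in>factors u n. excess w)"
    using sum_factors_Suc[of excess n] sum_excess[of n] sum_excess[of "Suc n"] by (simp add: s_def)
  have zero: "s v = 0" if "excess v = 0" for v
  proof -
    have "excess (v @ [c]) \<le> excess v" for c
    proof -
      have "left_ext u (v @ [c]) \<subseteq> left_ext u v"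
        using language_prefix[of "_ # v" "[c]" u] by (auto simp: left_ext_def)
      then show ?thesis
        unfolding excess_def by (intro diff_le_mono card_mono) simp_all
    qed
    then show ?thesis
      using that by (simp add: s_def)
  qed
  have pos: "s v \<ge> 1" if "v \<in> factors u n" "excess v \<ge> 1" for v
  proof -
    have "left_special A u v"
      using that by (auto simp: left_special_iff factors_def excess_def)
    then obtain c where "left_special A u (v @ [c])"
      using no_max[of v] by (auto simp: maximal_left_special_def)
    then have "c \<in> right_ext u v" "excess (v @ [c]) \<ge> 1"
      by (auto simp: left_special_iff right_ext_def excess_def)
    then show ?thesis
      unfolding s_def by (metis finite_right_ext le_trans member_le_sum zero_le)
  qed
  show ?thesis
  \<comment> \<open>A factor of excess 2 or more absorbs both sums, since all other terms vanish.
    Otherwise every excess is 0 or 1, so \<open>pos\<close> gives a termwise inequality, and equal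
    sums leave no strict one.\<close>
  proof (cases "\<exists>v\<in>factors u n. excess v \<ge> 2")
    case True
    then obtain v where v: "v \<in> factors u n" "excess v \<ge> 2"
      by blast
    have others: "excess x = 0" "s x = 0" if "x \<in> factors u n - {v}" for x
      using excess_unique[OF v, of x] zero that by auto
    have "(\<Sum>w\<in>factors u n. s w) = s v" "(\<Sum>w\<in>factors u n. excess w) = excess v"
      using others v(1) by (simp_all add: sum.remove)
    then have "s v = excess v"
      using sums by simp
    then show ?thesis
      using others[of w] w by (cases "w = v") (auto simp: s_def)
  next
    case False
    have le: "excess x \<le> s x" if "x \<in> factors u n" for x
      using False pos[of x] that by (cases "excess x = 0") (fastforce simp: not_le)+
    show ?thesis
    proof (rule ccontr)
      assume "\<not> ?thesis"
      then have "excess w < s w"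
        using le[OF w] by (simp add: s_def)
      then have "(\<Sum>w\<in>factors u n. excess w) < (\<Sum>w\<in>factors u n. s w)"
        using le w by (intro sum_strict_mono_ex1) auto
      then show False
        using sums by simp
    qed
  qed
qed

text \<open>In other words, every factor is neutral: it has |L| + |R| - 1 two-sided extensions,
  where L and R are its sets of left and right extensions.\<close>

lemma card_both_ext_eq:
  assumes "w \<in> language u"
  shows "card (both_ext u w) = excess w + card (right_ext u w)"
proof -
  have "card (both_ext u w) = (\<Sum>c\<in>right_ext u w. excess (w @ [c]) + 1)"
    unfolding card_both_ext
    by (intro sum.cong) (auto simp: excess_def right_ext_def dest!: card_left_ext_pos)
  then show ?thesis
    using sum_excess_extensions[OF assms] by (simp add: sum_Suc)
qed

lemma palindrome_right_ext: "palindrome p \<Longrightarrow> right_ext u p = left_ext u p"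
  using left_ext_rev[of p] by (simp add: palindrome_def)

lemma card_both_ext_palindrome:
  assumes "p \<in> language u" "palindrome p"
  shows "card (both_ext u p) = 2 * card (left_ext u p) - 1"
  using card_both_ext_eq[OF assms(1)] palindrome_right_ext[OF assms(2)] card_left_ext_pos[OF assms(1)]
  by (simp add: excess_def)

lemma odd_palindromic_extensions:
  assumes "p \<in> language u" "palindrome p"
  shows "odd (card {a. a # p @ [a] \<in> language u})"
proof -
  have "odd (card (both_ext u p))"
    using card_both_ext_palindrome[OF assms] card_left_ext_pos[OF assms(1)]
    by (auto simp: card_gt_0_iff Suc_le_eq)
  then show ?thesis
    using odd_card_symmetric_relation[OF finite_both_ext palindrome_both_ext_sym[OF assms(2)]]
    by (simp add: both_ext_def)
qed

section \<open>Counting palindromes\<close>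

definition palindromes :: "nat \<Rightarrow> 'a list set" where
  "palindromes n = {w \<in> factors u n. palindrome w}"

lemma finite_palindromes [simp]: "finite (palindromes n)"
  by (simp add: palindromes_def)

text \<open>An odd number is not 0, so each palindrome \<open>p\<close> has some palindromic
  extension \<open>a # p @ [a]\<close>, from which \<open>p\<close> can be recovered.\<close>

lemma card_palindromes_mono: "card (palindromes n) \<le> card (palindromes (n + 2))"
proof -
  have "\<exists>a. a # p @ [a] \<in> language u" if "p \<in> palindromes n" for p
  proof (rule ccontr)
    assume "\<not> ?thesis"
    then have "{a. a # p @ [a] \<in> language u} = {}"
      by simp
    then show False
      using odd_palindromic_extensions[of p] that by (simp add: palindromes_def factors_def)
  qed
  then obtain g where g: "\<And>p. p \<in> palindromes n \<Longrightarrow> g p # p @ [g p] \<in> language u"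
    by metis
  have "(\<lambda>p. g p # p @ [g p]) ` palindromes n \<subseteq> palindromes (n + 2)"
    using g by (auto simp: palindromes_def factors_def palindrome_def)
  moreover have "inj_on (\<lambda>p. g p # p @ [g p]) (palindromes n)"
    by (auto simp: inj_on_def)
  ultimately show ?thesis
    using card_inj_on_le finite_palindromes by blast
qed

text \<open>The empty word and the three letters give 1 + 3 at the start. Each step trades the
  palindromes of length \<open>n\<close> for those of length \<open>n + 2\<close>, of which there
  are no fewer.\<close>

lemma card_palindromes_consecutive: "card (palindromes n) + card (palindromes (Suc n)) \<ge> 4"
proof (induction n)
  case 0
  have "palindromes 0 = factors u 0" "palindromes (Suc 0) = factors u (Suc 0)"
    by (auto simp: palindromes_def factors_def palindrome_def length_Suc_conv)
  then show ?case
    using compl[of 0] compl[of 1] by (simp add: complexity_def)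
next
  case (Suc n)
  then show ?case
    using card_palindromes_mono[of n] by simp
qed

text \<open>The strict inequality of lengths makes the prefix and the suffix two different
  occurrences of \<open>p\<close>; they may overlap.\<close>

definition complete_return :: "'a list \<Rightarrow> 'a list \<Rightarrow> bool" where
  "complete_return p r \<longleftrightarrow> r \<in> language u \<and> length p < length r \<and>
     (\<forall>q. q + length p \<le> length r \<longrightarrow>
        (take (length p) (drop q r) = p \<longleftrightarrow> q = 0 \<or> q + length p = length r))"

lemma complete_return_window:
  assumes "complete_return p r" "q + length p \<le> length r"
  shows "take (length p) (drop q r) = p \<longleftrightarrow> q = 0 \<or> q + length p = length r"
  using assms unfolding complete_return_def by blast

end

section \<open>Complete returns to a palindrome with three left extensions\<close>

locale trispecial_palindrome = ternary_word +
  fixes p :: "'a list"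
  assumes in_language: "p \<in> language u"
    and palin: "palindrome p"
    and trispecial: "card (left_ext u p) = 3"
begin

lemma excess_p: "excess p = 2"
  using trispecial by (simp add: excess_def)

lemma left_ext_p: "left_ext u p = A"
  using card_subset_eq[OF finite_alphabet left_ext_subset] trispecial ternary by simp

text \<open>The factor \<open>p\<close> uses up the whole excess 2 available at its length.\<close>

lemma unique_left_ext:
  assumes "length v = length p" "v \<noteq> p" "a # v \<in> language u" "b # v \<in> language u"
  shows "a = b"
proof -
  have "v \<in> language u"
    using assms(3) by (rule language_tl)
  then have "excess v = 0"
    using excess_unique[of p "length p" v] excess_p in_language assms(1,2) by (simp add: factors_def)
  then have "card (left_ext u v) \<le> Suc 0"
    by (simp add: excess_def)
  then have "\<forall>x\<in>left_ext u v. \<forall>y\<in>left_ext u v. x = y"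
    by (simp add: card_le_Suc0_iff_eq)
  then show ?thesis
    using assms(3,4) by (simp add: left_ext_def)
qed

lemma unique_right_ext:
  assumes "length v = length p" "v \<noteq> p" "v @ [a] \<in> language u" "v @ [b] \<in> language u"
  shows "a = b"
proof (rule unique_left_ext)
  show "rev v \<noteq> p"
    using assms(2) palin unfolding palindrome_def by (metis rev_rev_ident)
  show "a # rev v \<in> language u" "b # rev v \<in> language u"
    using assms(3,4) rev_in_language[of "v @ [_]"] by simp_all
qed (simp add: assms)

text \<open>After the letter that follows the prefix \<open>p\<close>, every window of length
  \<open>|p|\<close> before the last differs from \<open>p\<close>, so it determines the next
  letter. Both words thus agree until \<open>p\<close> reappears, which ends them both.\<close>

lemma complete_return_eqI:
  assumes r: "complete_return p r" and r': "complete_return p r'"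
    and eq: "r ! length p = r' ! length p"
  shows "r = r'"
proof -
  let ?n = "length p"
  have prefix: "take m r = take m r'" if "m \<le> length r" "m \<le> length r'" for m
    using that
  proof (induction m)
    case 0
    then show ?case by simp
  next
    case (Suc m)
    then have IH: "take m r = take m r'" and m: "m < length r" "m < length r'"
      by simp_all
    have p: "take ?n r = p" "take ?n r' = p"
      using complete_return_window[OF r, of 0] complete_return_window[OF r', of 0] r r'
      by (simp_all add: complete_return_def)
    have "r ! m = r' ! m"
    proof (cases "m \<le> ?n")
      case True
      show ?thesis
      proof (cases "m = ?n")
        case False
        then show ?thesis
          using True nth_take[of m ?n r] nth_take[of m ?n r'] p by simp
      qed (simp add: eq)
    next
      case False
      define w where "w = take ?n (drop (m - ?n) r)"
      have w': "w = take ?n (drop (m - ?n) r')"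
        using arg_cong[OF IH, of "drop (m - ?n)"] False by (simp add: w_def drop_take)
      have "w \<noteq> p"
        using complete_return_window[OF r, of "m - ?n"] False m by (simp add: w_def)
      moreover have "length w = ?n"
        using False m by (simp add: w_def)
      moreover have "w @ [r ! m] = take (Suc ?n) (drop (m - ?n) r)"
        using False m by (simp add: w_def take_Suc_conv_app_nth)
      moreover have "w @ [r' ! m] = take (Suc ?n) (drop (m - ?n) r')"
        using False m by (simp add: w' take_Suc_conv_app_nth)
      ultimately show ?thesis
        using unique_right_ext[of w "r ! m" "r' ! m"] r r'
        by (simp add: complete_return_def language_window)
    qed
    then show ?case
      using IH m by (simp add: take_Suc_conv_app_nth)
  qed
  \<comment> \<open>The final \<open>p\<close> of the shorter word also occurs in the longer one, at
    a positive position, so it must be final there too.\<close>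
  have len: "length x = length y"
    if x: "complete_return p x" and y: "complete_return p y" and "length x \<le> length y"
      and "take (length x) x = take (length x) y" for x y
  proof -
    have lt: "?n < length x"
      using x by (simp add: complete_return_def)
    define q where "q = length x - ?n"
    have q: "0 < q" "q + ?n = length x"
      using lt by (simp_all add: q_def)
    have "take ?n (drop q x) = take ?n (drop q y)"
      using arg_cong[OF that(4), of "drop q"] q(2)[symmetric] by (simp add: drop_take)
    moreover have "take ?n (drop q x) = p"
      using complete_return_window[OF x, of q] q by simp
    ultimately have "q + ?n = length y"
      using complete_return_window[OF y, of q] q \<open>length x \<le> length y\<close> by simp
    then show ?thesis
      using q(2) by simp
  qed
  have "length r = length r'"
  proof (cases "length r \<le> length r'")
    case True
    show ?thesis
      by (rule len[OF r r' True prefix[OF order.refl True]])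
  next
    case False
    then have le: "length r' \<le> length r"
      by simp
    show ?thesis
      by (rule len[OF r' r le prefix[OF le order.refl, symmetric], symmetric])
  qed
  then show ?thesis
    using prefix by (metis order.refl take_all)
qed

text \<open>The palindrome grows outward from \<open>v\<close>, one letter of \<open>s\<close> at a
  time. Its prefix of length \<open>|p|\<close> is not \<open>p\<close>, so the letter on its left
  is forced, and by symmetry the same letter is forced on its right.\<close>

lemma mirror_extension:
  assumes "s @ v \<in> language u" "palindrome v" "length p \<le> length v"
    and "\<And>q. 0 < q \<Longrightarrow> q \<le> length s \<Longrightarrow> take (length p) (drop q (s @ v)) \<noteq> p"
  shows "s @ v @ rev s \<in> language u"
  using assms
proof (induction s)
  case Nil
  then show ?case by simp
next
  case (Cons x s)
  let ?n = "length p"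
  define r where "r = s @ v @ rev s"
  have "r \<in> language u"
    unfolding r_def
  proof (rule Cons.IH)
    show "s @ v \<in> language u"
      using Cons.prems(1) language_tl by simp
    show "take ?n (drop q (s @ v)) \<noteq> p" if "0 < q" "q \<le> length s" for q
      using Cons.prems(4)[of "Suc q"] that by simp
  qed (use Cons.prems in auto)
  have rr: "rev r = r"
    using Cons.prems(2) by (simp add: r_def palindrome_def)
  \<comment> \<open>This window starts at position 1 of \<open>(x # s) @ v\<close>, where
    \<open>p\<close> is excluded; only position 0 may carry \<open>p\<close>.\<close>
  define h where "h = take ?n (s @ v)"
  have h: "length h = ?n" "h \<noteq> p" "h = take ?n r"
    using Cons.prems(3) Cons.prems(4)[of 1] by (simp_all add: h_def r_def)
  have r1: "r = h @ drop ?n r"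
    using h(3) by simp
  then have r2: "r = rev (drop ?n r) @ rev h"
    using rr by (metis rev_append)
  have "(x # h) @ drop ?n (s @ v) = (x # s) @ v"
    unfolding h_def by (simp del: take_append drop_append)
  then have xh: "x # h \<in> language u"
    using Cons.prems(1) language_prefix by metis
  have left: "y = x" if "y # r \<in> language u" for y
    using that r1 unique_left_ext[OF h(1,2) _ xh] language_prefix[of "y # h" "drop ?n r" u] by simp
  obtain y where "y # r \<in> language u"
    using left_ext_nonempty[OF \<open>r \<in> language u\<close>] by (auto simp: left_ext_def)
  then have xr: "x # r \<in> language u"
    using left by blast
  obtain z where z: "(x # r) @ [z] \<in> language u"
    using right_ext_nonempty[OF xr] by (auto simp: right_ext_def)
  \<comment> \<open>Since \<open>r\<close> is a palindrome, reversal turns its right extension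
    \<open>z\<close> into a left one.\<close>
  then have "rev (r @ [z]) \<in> language u"
    using language_tl[of x "r @ [z]" u] unfolding rev_in_language by simp
  then have "z = x"
    using left rr by simp
  then show ?case
    using z by (simp add: r_def)
qed

lemma take_drop_palindrome:
  assumes "rev r = r" "q + length p \<le> length r"
  shows "take (length p) (drop q r) = p \<longleftrightarrow> take (length p) (drop (length r - length p - q) r) = p"
proof -
  have "rev (take (length p) (drop q r)) = take (length p) (drop (length r - length p - q) (rev r))"
    using assms(2) by (simp add: rev_take rev_drop drop_take min_def add.commute)
  then show ?thesis
    using assms(1) palin unfolding palindrome_def by (metis rev_rev_ident)
qed

text \<open>Take an occurrence of \<open>v\<close> and the last \<open>p\<close> starting no later;
  the stretch between the two starts is \<open>s\<close>, and \<open>mirror_extension\<close>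
  reflects it behind \<open>v\<close>.\<close>

lemma complete_return_centred_at:
  assumes v: "v \<in> language u" "palindrome v" "v \<noteq> p" "length v = length p \<or> length v = Suc (length p)"
  shows "\<exists>s. complete_return p (s @ v @ rev s)"
proof -
  let ?n = "length p"
  obtain i0 where i0: "p = u [i0 \<rightarrow> i0 + ?n]"
    using in_language language_iff by metis
  \<comment> \<open>Recurrence places \<open>v\<close> after some occurrence of \<open>p\<close>, so
    that a last one exists.\<close>
  obtain k where k: "k \<ge> i0" "v = u [k \<rightarrow> k + length v]"
    using occurs_beyond[OF v(1)] by metis
  define P where "P i \<longleftrightarrow> i \<le> k \<and> u [i \<rightarrow> i + ?n] = p" for i
  define i where "i = (GREATEST i. P i)"
  have Pi: "P i"
    unfolding i_def by (rule GreatestI_nat[of P i0 k]) (use i0 k in \<open>auto simp: P_def\<close>)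
  have max: "\<not> P j" if "j > i" for j
    using Greatest_le_nat[of P j k] that unfolding i_def[symmetric] by (auto simp: P_def)
  define s where "s = u [i \<rightarrow> k]"
  have ik: "i \<le> k"
    using Pi by (simp add: P_def)
  have sv: "s @ v = u [i \<rightarrow> k + length v]" "length s = k - i"
    using ik by (subst k(2)) (simp_all add: s_def subsequence_def upt_add_eq_append[of i k])
  have nv: "?n \<le> length v"
    using v(4) by auto
  have win: "take ?n (drop q (s @ v)) = u [i + q \<rightarrow> i + q + ?n]" if "q \<le> length s" for q
    unfolding sv using that sv(2) ik nv by (simp add: subsequence_def drop_map take_map)
  have first: "take ?n (s @ v) = p"
    using win[of 0] Pi by (simp add: P_def)
  have inner: "take ?n (drop q (s @ v)) \<noteq> p" if "0 < q" "q \<le> length s" for q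
    using win[OF that(2)] max[of "i + q"] that sv(2) by (auto simp: P_def)
  define r where "r = s @ v @ rev s"
  have "r \<in> language u"
    unfolding r_def
    by (rule mirror_extension) (use sv(1) subsequence_in_language[of u] v(2) nv inner in simp_all)
  have rr: "rev r = r"
    using v(2) by (simp add: r_def palindrome_def)
  have len: "length r = 2 * length s + length v"
    by (simp add: r_def)
  have lt: "?n < length r"
  \<comment> \<open>Only \<open>s = []\<close> with \<open>v\<close> of length \<open>|p|\<close>
    could fail, but then \<open>v\<close> would be \<open>p\<close>.\<close>
  proof (rule ccontr)
    assume "\<not> ?n < length r"
    then have "length s = 0" "length v = ?n"
      using nv len by linarith+
    then have "s = []" "length v = ?n"
      by simp_all
    then show False
      using first v(3) by simp
  qed
  have win_r: "take ?n (drop q r) = take ?n (drop q (s @ v))" if "q \<le> length s" for q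
    using that nv by (simp add: r_def)
  have low: "take ?n (drop q r) = p \<longleftrightarrow> q = 0" if "q \<le> length s" for q
    using win_r[OF that] first inner that by (cases "q = 0") auto
  have "take ?n (drop q r) = p \<longleftrightarrow> q = 0 \<or> q + ?n = length r" if q: "q + ?n \<le> length r" for q
  proof (cases "q \<le> length s")
    case True
    then show ?thesis
      using low[OF True] len nv lt by auto
  next
    case False
    \<comment> \<open>As \<open>v\<close> has length at most \<open>|p| + 1\<close>, a window
      starting beyond \<open>length s\<close> is the mirror image of one starting at or before
      it.\<close>
    then have "length r - ?n - q \<le> length s"
      using len v(4) by auto
    then show ?thesis
      using low take_drop_palindrome[OF rr q] False q by auto
  qed
  then have "complete_return p r"
    using \<open>r \<in> language u\<close> lt by (simp add: complete_return_def)
  then show ?thesis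
    unfolding r_def by blast
qed

text \<open>
  The palindromes of length \<open>|p|\<close> and \<open>|p| + 1\<close> other than \<open>p\<close> are the possible centres of
  palindromic complete returns to \<open>p\<close>. There are at least three of them, and a complete return
  is determined by the letter following its prefix \<open>p\<close>; so every letter is accounted for.
\<close>

lemma palindromic_complete_return:
  assumes "c \<in> A"
  shows "\<exists>r. complete_return p r \<and> palindrome r \<and> r ! length p = c"
proof -
  let ?n = "length p"
  define V where "V = palindromes ?n \<union> palindromes (Suc ?n) - {p}"
  have V: "v \<in> language u" "palindrome v" "v \<noteq> p" "length v = ?n \<or> length v = Suc ?n"
    if "v \<in> V" for v
    using that by (auto simp: V_def palindromes_def factors_def)
  obtain s where s: "\<And>v. v \<in> V \<Longrightarrow> complete_return p (s v @ v @ rev (s v))"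
    using complete_return_centred_at V by metis
  define f where "f v = (s v @ v @ rev (s v)) ! ?n" for v
  have "inj_on f V"
  \<comment> \<open>Equal letters give equal complete returns. The lengths of two centres differ by
    at most 1, so parity makes them equal, and the centres coincide.\<close>
  proof (rule inj_onI)
    fix v w assume vw: "v \<in> V" "w \<in> V" "f v = f w"
    then have eq: "s v @ v @ rev (s v) = s w @ w @ rev (s w)"
      using complete_return_eqI[OF s s] by (simp add: f_def)
    from arg_cong[OF eq, of length]
    have "2 * length (s v) + length v = 2 * length (s w) + length w"
      by (simp only: length_append length_rev)
    then have "length (s v) = length (s w) \<and> length v = length w"
      using V(4)[OF vw(1)] V(4)[OF vw(2)] by presburger
    then show "v = w"
      using eq by simp
  qed
  have fA: "f ` V \<subseteq> A"
  proof
    fix x assume "x \<in> f ` V"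
    then obtain v where "v \<in> V" "x = f v"
      by blast
    then show "x \<in> A"
      using s[of v] letters_in_alphabet[of "s v @ v @ rev (s v)"] nth_mem[of ?n "s v @ v @ rev (s v)"]
      unfolding complete_return_def f_def by blast
  qed
  have "card V \<ge> 3"
  proof -
    have "palindromes ?n \<inter> palindromes (Suc ?n) = {}"
      by (auto simp: palindromes_def factors_def)
    then have "card (palindromes ?n \<union> palindromes (Suc ?n)) \<ge> 4"
      using card_palindromes_consecutive[of ?n] by (simp add: card_Un_disjoint)
    moreover have "p \<in> palindromes ?n"
      using in_language palin by (simp add: palindromes_def factors_def)
    ultimately show ?thesis
      by (simp add: V_def)
  qed
  then have "f ` V = A"
    using card_image[OF \<open>inj_on f V\<close>] fA finite_alphabet ternary
    by (intro card_seteq) auto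
  then obtain v where "v \<in> V" "f v = c"
    using assms by blast
  then show ?thesis
    using s[of v] V(2)[of v] by (auto simp: f_def palindrome_def)
qed

text \<open>If \<open>c\<close> were isolated, then from some \<open>pc\<close> onward every
  \<open>p\<close> would be followed by \<open>c\<close>, the letter being handed on through
  palindromic complete returns. Recurrence of \<open>pa\<close> for another letter \<open>a\<close>
  rules this out.\<close>

lemma not_isolated:
  assumes "c \<in> A"
  shows "\<exists>x. x \<noteq> c \<and> (c, x) \<in> both_ext u p"
proof (rule ccontr)
  let ?n = "length p"
  assume "\<not> ?thesis"
  then have isolated: "x = c" if "c # p @ [x] \<in> language u" for x
    using that by (auto simp: both_ext_def)
  have ext: "p @ [x] \<in> language u" if "x \<in> A" for x
    using palindrome_right_ext[OF palin] left_ext_p that by (auto simp: right_ext_def)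
  have follow: "u [k \<rightarrow> k + ?n] = p \<and> u (k + ?n) = x"
    if "p @ [x] = u [k \<rightarrow> k + length (p @ [x])]" for k x
    using that by (simp add: subsequence_def)
  obtain i where i: "u [i \<rightarrow> i + ?n] = p" "u (i + ?n) = c"
    using language_iff[of "p @ [c]" u] ext[OF assms] follow by blast
  have forced: "u (k + ?n) = c" if "k \<ge> i" "u [k \<rightarrow> k + ?n] = p" for k
    using that
  proof (induction k rule: less_induct)
    case (less k)
    show ?case
    proof (cases "k = i")
      case False
      \<comment> \<open>The previous occurrence of \<open>p\<close> is the last one starting before
        \<open>k\<close>; together with the one at \<open>k\<close> it bounds a complete
        return.\<close>
      define P where "P j \<longleftrightarrow> j < k \<and> u [j \<rightarrow> j + ?n] = p" for j
      define j where "j = (GREATEST j. P j)"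
      have "P i"
        using i False less.prems by (simp add: P_def)
      have bound: "\<forall>j. P j \<longrightarrow> j \<le> k"
        by (simp add: P_def)
      have "P j"
        unfolding j_def using GreatestI_nat[of P i k] \<open>P i\<close> bound by blast
      have max: "m \<le> j" if "P m" for m
        unfolding j_def using Greatest_le_nat[of P m k] that bound by blast
      have j: "i \<le> j" "j < k" "u [j \<rightarrow> j + ?n] = p"
        using max[OF \<open>P i\<close>] \<open>P j\<close> by (simp_all add: P_def)
      have next_letter: "u (j + ?n) = c"
        using less.IH j by blast
      define r where "r = u [j \<rightarrow> k + ?n]"
      have len: "length r = k + ?n - j"
        by (simp add: r_def)
      have "take ?n (drop q r) = p \<longleftrightarrow> q = 0 \<or> q + ?n = length r"
        if q: "q + ?n \<le> length r" for q
      proof -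
        have win: "take ?n (drop q r) = u [j + q \<rightarrow> j + q + ?n]"
          using q j(2) by (simp add: r_def subsequence_def drop_map take_map)
        consider "q = 0" | "j + q = k" | "q > 0" "j + q < k"
          using q len by linarith
        then show ?thesis
        proof cases
          case 1
          then show ?thesis
            using win j(3) by simp
        next
          case 2
          then have "q + ?n = length r"
            using len by linarith
          then show ?thesis
            unfolding win 2 using less.prems(2) by blast
        next
          case 3
          then have "u [j + q \<rightarrow> j + q + ?n] \<noteq> p"
            using max[of "j + q"] by (auto simp: P_def)
          then show ?thesis
            unfolding win using 3 len by linarith
        qed
      qed
      then have r: "complete_return p r"
        using j(2) len subsequence_in_language[of u] by (simp add: complete_return_def r_def)
      have rn: "r ! ?n = c"
        using next_letter j(2) by (simp add: r_def subsequence_def)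
      have "palindrome r"
        using palindromic_complete_return[OF assms] complete_return_eqI[OF r] rn by metis
      \<comment> \<open>This index is that of the letter just before the final \<open>p\<close>, at
        position \<open>k - 1\<close> of \<open>u\<close>.\<close>
      then have "r ! (length r - Suc ?n) = c"
        using rn rev_nth[of ?n r] len j(2) by (simp add: palindrome_def)
      then have "u (k - 1) = c"
        using len j(2) by (simp add: r_def subsequence_def)
      moreover have "u [k - 1 \<rightarrow> Suc (k + ?n)] = u (k - 1) # u [k \<rightarrow> k + ?n] @ [u (k + ?n)]"
        using j(2) by (simp add: subsequence_def upt_conv_Cons)
      ultimately show ?thesis
        using isolated less.prems(2) subsequence_in_language[of u] by metis
    qed (simp add: i)
  qed
  have "\<not> A \<subseteq> {c}"
    using card_mono[of "{c}" A] ternary by auto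
  then obtain a where a: "a \<in> A" "a \<noteq> c"
    by blast
  obtain k where "k \<ge> i" "p @ [a] = u [k \<rightarrow> k + length (p @ [a])]"
    using occurs_beyond[OF ext[OF a(1)]] by blast
  then show False
    using follow forced a(2) by blast
qed

text \<open>Three loops and an off-diagonal pair \<open>(c, g c)\<close> for each letter
  \<open>c\<close> would make six two-sided extensions, but \<open>p\<close> has only 2 * 3 - 1 =
  5.\<close>

lemma not_all_loops: "\<exists>a\<in>A. a # p @ [a] \<notin> language u"
proof (rule ccontr)
  assume "\<not> ?thesis"
  then have loops: "(a, a) \<in> both_ext u p" if "a \<in> A" for a
    using that by (simp add: both_ext_def)
  obtain g where g: "\<And>c. c \<in> A \<Longrightarrow> g c \<noteq> c \<and> (c, g c) \<in> both_ext u p"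
    using not_isolated by metis
  have "(\<lambda>c. (c, c)) ` A \<union> (\<lambda>c. (c, g c)) ` A \<subseteq> both_ext u p"
    using loops g by auto
  then have "card ((\<lambda>c. (c, c)) ` A \<union> (\<lambda>c. (c, g c)) ` A) \<le> card (both_ext u p)"
    by (intro card_mono) simp_all
  moreover have "card ((\<lambda>c. (c, c)) ` A \<union> (\<lambda>c. (c, g c)) ` A) = 6"
  proof -
    have "(\<lambda>c. (c, c)) ` A \<inter> (\<lambda>c. (c, g c)) ` A = {}"
      using g by fastforce
    moreover have "card ((\<lambda>c. (c, c)) ` A) = 3" "card ((\<lambda>c. (c, g c)) ` A) = 3"
      using ternary by (simp_all add: card_image inj_on_def)
    ultimately show ?thesis
      using finite_alphabet by (simp add: card_Un_disjoint)
  qed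
  ultimately show False
    using card_both_ext_palindrome[OF in_language palin] trispecial by simp
qed

end

theorem theorem2:
  fixes A :: "'a set" and u :: "'a word"
  assumes ternary: "card A = 3"
    and word_over_A: "range u \<subseteq> A"
    and reversal: "closed_under_reversal u"
    and compl: "\<forall>n. complexity u n = 2 * n + 1"
    and no_max: "\<nexists>w. maximal_left_special A u w"
  shows "property_PE A u"
proof -
  have "finite A"
    using ternary by (simp add: card_ge_0_finite)
  then interpret ternary_word A u
    using assms by unfold_locales auto
  show ?thesis
    unfolding property_PE_def
  proof (intro ballI impI)
    fix p assume p: "p \<in> language u" "palindrome p"
    define D where "D = {a. a # p @ [a] \<in> language u}"
    have "D \<subseteq> left_ext u p"
      using language_prefix[of "_ # p" "[_]" u] by (auto simp: D_def left_ext_def)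
    then have DA: "D \<subseteq> A"
      using left_ext_subset by blast
    have odd: "odd (card D)"
      using odd_palindromic_extensions[OF p] by (simp add: D_def)
    \<comment> \<open>An odd number up to 3 is 1 or 3, so only the case where all three letters
      extend \<open>p\<close> to a palindrome has to be refuted.\<close>
    have "card D \<noteq> 3"
    proof
      assume D3: "card D = 3"
      then have "D = A"
        using card_subset_eq[OF finite_alphabet DA] ternary by simp
      moreover from this have "left_ext u p = A"
        using \<open>D \<subseteq> left_ext u p\<close> left_ext_subset by blast
      then interpret trispecial_palindrome A u p
        using p ternary by unfold_locales auto
      have "\<exists>a\<in>A. a # p @ [a] \<notin> language u"
        by (rule not_all_loops)
      ultimately show False
        by (auto simp: D_def)
    qed
    moreover have "card D \<le> 3"
      using card_mono[OF finite_alphabet DA] ternary by simp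
    ultimately have "card D = 1"
      using odd by presburger
    then obtain a where "D = {a}"
      using card_1_singletonE by blast
    then have "a \<in> A" "\<And>x. x # p @ [x] \<in> language u \<longleftrightarrow> x = a"
      using DA by (auto simp: D_def)
    then show "\<exists>!a. a \<in> A \<and> a # p @ [a] \<in> language u"
      by auto
  qed
qed

end
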